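(* Let $f:\mathbb{R}^n\to\mathbb{R}$ and $G:\mathbb{R}^n\to S^p$ be twice continuously differentiable, and let $(\bar x,\bar y)$ be a KKT point of the problem $\min f(x)$ s.t. $G(x)\in S^p_+$. Let $A=G(\bar x)+\bar y$ have an eigenvalue decomposition $A=P\,\mathrm{Diag}(\Lambda_\alpha,0_\beta,\Lambda_\gamma)P^T$ with $P$ orthogonal, where $\alpha,\beta,\gamma$ are the index sets of the positive, zero and negative eigenvalues of $A$. Then $\bar y$ is critical if and only if there is a pair $(\xi,\eta)\in\mathbb{R}^n\times S^p$ with $\xi\ne0$ satisfying $$\nabla^2_{xx}L(\bar x,\bar y)\xi+G'(\bar x)^*\eta=0,$$ $$(P^TG'(\bar x)\xi P)_{\beta\gamma}=0,\quad (P^TG'(\bar x)\xi P)_{\gamma\gamma}=0,\quad (P^T\eta P)_{\alpha\alpha}=0,\quad (P^T\eta P)_{\alpha\beta}=0,$$ $$(\Sigma_{\alpha\gamma}-E_{\alpha\gamma})\circ(P^TG'(\bar x)\xi P)_{\alpha\gamma}+\Sigma_{\alpha\gamma}\circ(P^T\eta P)_{\alpha\gamma}=0,$$ $$S^{|\beta|}_+\ni(P^TG'(\bar x)\xi P)_{\beta\beta}\perp(P^T\eta P)_{\beta\beta}\in S^{|\beta|}_-.$$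
   Context: $S^p$ is the space of real symmetric $p\times p$ matrices with the trace inner product; $S^p_+$ (resp. $S^p_-$) is the cone of positive (resp. negative) semidefinite matrices. $L(x,y)=f(x)+\langle y,G(x)\rangle$ for $(x,y)\in\mathbb{R}^n\times S^p$. $G'(\bar x):\mathbb{R}^n\to S^p$ is the derivative and $G'(\bar x)^*$ its adjoint; $P^TG'(\bar x)\xi P$ means $P^T(G'(\bar x)\xi)P$. For index sets $I,J$, $M_{IJ}$ is the corresponding submatrix of $M$; $\circ$ is the Hadamard (entrywise) product; $E$ is the all-ones matrix. $\Sigma\in S^p$ has entries $\Sigma_{ij}=\dfrac{\max\{\lambda_i(A),0\}-\max\{\lambda_j(A),0\}}{\lambda_i(A)-\lambda_j(A)}$, $i,j=1,\dots,p$, with $0/0:=1$, where $\lambda_i(A)$ is the eigenvalue of $A$ for the $i$-th column of $P$. $N(x;\Omega)$ is the normal cone of convex analysis to the convex set $\Omega$ at $x\in\Omega$, and empty if $x\notin\Omega$. For feasible $\bar x$, $\Lambda(\bar x)=\{y\in S^p:\nabla_xL(\bar x,y)=0,\ y\in N(G(\bar x);S^p_+)\}$; $(\bar x,\bar y)$ is a KKT point if $\bar x$ is feasible and $\bar y\in\Lambda(\bar x)$. For a set $\Omega$ in a finite-dimensional Hilbert space and $z\in\Omega$, the tangent cone is $T(z;\Omega)=\limsup_{t\downarrow0}(\Omega-z)/t$ (outer limit). For a set-valued mapping $F$ with $(u,v)\in\operatorname{gph}F$, the graphical derivative is $DF(u,v)(h)=\{k:(h,k)\in T((u,v);\operatorname{gph}F)\}$.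 Let $\mathcal N:S^p\rightrightarrows S^p$, $\mathcal N(X)=N(X;S^p_+)$ (the subdifferential of the indicator function of $S^p_+$). A multiplier $\bar y\in\Lambda(\bar x)$ is critical if there is $\xi\in\mathbb{R}^n$, $\xi\neq0$, with $0\in\nabla^2_{xx}L(\bar x,\bar y)\xi+G'(\bar x)^*\,D\mathcal N(G(\bar x),\bar y)(G'(\bar x)\xi)$. *)

theory Defs
  imports "HOL-Analysis.Analysis"
begin

text \<open>
  The space \<open>S\<^sup>p\<close> is the subspace \<open>sym_mats\<close> of \<^typ>\<open>real^'p^'p\<close>. The library inner product
  of \<^typ>\<open>real^'p^'p\<close> restricts to the trace inner product there:
\<close>

lemma inner_matrix_eq_trace:
  fixes A B :: "real^'p^'p"
  shows "A \<bullet> B = trace (transpose A ** B)"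
proof -
  have "A \<bullet> B = (\<Sum>i\<in>UNIV. \<Sum>j\<in>UNIV. A $ i $ j * B $ i $ j)"
    by (simp add: inner_vec_def)
  also have "\<dots> = (\<Sum>j\<in>UNIV. \<Sum>i\<in>UNIV. A $ i $ j * B $ i $ j)"
    by (rule sum.swap)
  also have "\<dots> = trace (transpose A ** B)"
    by (simp add: trace_def matrix_matrix_mult_def transpose_def)
  finally show ?thesis .
qed

definition sym_mats :: "(real^'p^'p) set" where
  "sym_mats = {M. transpose M = M}"

definition psd_cone :: "(real^'p^'p) set" where
  "psd_cone = {M \<in> sym_mats. \<forall>u. 0 \<le> u \<bullet> (M *v u)}"

definition diag_mat :: "real^'p \<Rightarrow> real^'p^'p" where
  "diag_mat d = (\<chi> i j. if i = j then d $ i else 0)"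

text \<open>Statements about the principal submatrix \<open>M\<^bsub>II\<^esub>\<close>: membership in \<open>S\<^sup>|\<^sup>I\<^sup>|\<^sub>+\<close> and in
  \<open>S\<^sup>|\<^sup>I\<^sup>|\<^sub>-\<close>, and the trace inner product of two such blocks.\<close>

definition psd_block :: "'p set \<Rightarrow> real^'p^'p \<Rightarrow> bool" where
  "psd_block I M \<longleftrightarrow>
     (\<forall>i\<in>I. \<forall>j\<in>I. M $ i $ j = M $ j $ i) \<and>
     (\<forall>u::'p \<Rightarrow> real. 0 \<le> (\<Sum>i\<in>I. \<Sum>j\<in>I. u i * M $ i $ j * u j))"

definition nsd_block :: "'p set \<Rightarrow> real^'p^'p \<Rightarrow> bool" where
  "nsd_block I M \<longleftrightarrow>
     (\<forall>i\<in>I. \<forall>j\<in>I. M $ i $ j = M $ j $ i) \<and>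
     (\<forall>u::'p \<Rightarrow> real. (\<Sum>i\<in>I. \<Sum>j\<in>I. u i * M $ i $ j * u j) \<le> 0)"

definition inner_block :: "'p set \<Rightarrow> real^'p^'p \<Rightarrow> real^'p^'p \<Rightarrow> real" where
  "inner_block I M N = (\<Sum>i\<in>I. \<Sum>j\<in>I. M $ i $ j * N $ i $ j)"

definition Sigma_mat :: "real^'p \<Rightarrow> real^'p^'p" where
  "Sigma_mat d = (\<chi> i j. if d $ i = d $ j then 1
     else (max (d $ i) 0 - max (d $ j) 0) / (d $ i - d $ j))"

text \<open>The parameter \<open>V\<close> is the ambient space: normals are taken within the subspace \<open>V\<close>.\<close>

definition normal_cone :: "'a::real_inner set \<Rightarrow> 'a \<Rightarrow> 'a set \<Rightarrow> 'a set" where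
  "normal_cone V x \<Omega> = (if x \<in> \<Omega> then {v \<in> V. \<forall>z\<in>\<Omega>. v \<bullet> (z - x) \<le> 0} else {})"

definition tangent_cone :: "'a::real_normed_vector \<Rightarrow> 'a set \<Rightarrow> 'a set" where
  "tangent_cone z \<Omega> =
     {w. \<exists>(t::nat \<Rightarrow> real) ws. (\<forall>k. 0 < t k) \<and> t \<longlonglongrightarrow> 0 \<and> ws \<longlonglongrightarrow> w \<and>
           (\<forall>k. ws k \<in> (\<lambda>s. (s - z) /\<^sub>R t k) ` \<Omega>)}"

definition gph :: "('a \<Rightarrow> 'b set) \<Rightarrow> ('a \<times> 'b) set" where
  "gph F = {(u, v). v \<in> F u}"

definition graphical_derivative ::
  "('a::real_normed_vector \<Rightarrow> 'b::real_normed_vector set) \<Rightarrow> 'a \<Rightarrow> 'b \<Rightarrow> 'a \<Rightarrow> 'b set" where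
  "graphical_derivative F u v h = {k. (h, k) \<in> tangent_cone (u, v) (gph F)}"

definition psd_normal :: "real^'p^'p \<Rightarrow> (real^'p^'p) set" where
  "psd_normal X = normal_cone sym_mats X psd_cone"

definition twice_cont_differentiable ::
  "('a::real_normed_vector \<Rightarrow> 'b::real_normed_vector) \<Rightarrow> bool" where
  "twice_cont_differentiable g \<longleftrightarrow>
     (\<exists>(g' :: 'a \<Rightarrow> 'a \<Rightarrow>\<^sub>L 'b) (g'' :: 'a \<Rightarrow> 'a \<Rightarrow>\<^sub>L ('a \<Rightarrow>\<^sub>L 'b)).
        (\<forall>x. (g has_derivative blinfun_apply (g' x)) (at x)) \<and>
        (\<forall>x. (g' has_derivative blinfun_apply (g'' x)) (at x)) \<and>
        continuous_on UNIV g'')"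

definition gradient :: "('a::real_inner \<Rightarrow> real) \<Rightarrow> 'a \<Rightarrow> 'a" where
  "gradient g x = (THE d. GDERIV g x :> d)"

text \<open>The Hessian as a linear operator, namely the derivative of the gradient map.\<close>

definition hessian :: "('a::real_inner \<Rightarrow> real) \<Rightarrow> 'a \<Rightarrow> 'a \<Rightarrow> 'a" where
  "hessian g x = frechet_derivative (gradient g) (at x)"

definition Lagrangian ::
  "(real^'n \<Rightarrow> real) \<Rightarrow> (real^'n \<Rightarrow> real^'p^'p) \<Rightarrow> real^'p^'p \<Rightarrow> real^'n \<Rightarrow> real" where
  "Lagrangian f G y x = f x + y \<bullet> G x"

definition multipliers ::
  "(real^'n \<Rightarrow> real) \<Rightarrow> (real^'n \<Rightarrow> real^'p^'p) \<Rightarrow> real^'n \<Rightarrow> (real^'p^'p) set" where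
  "multipliers f G x =
     {y \<in> sym_mats. gradient (Lagrangian f G y) x = 0 \<and> y \<in> normal_cone sym_mats (G x) psd_cone}"

definition KKT_point ::
  "(real^'n \<Rightarrow> real) \<Rightarrow> (real^'n \<Rightarrow> real^'p^'p) \<Rightarrow> real^'n \<Rightarrow> real^'p^'p \<Rightarrow> bool" where
  "KKT_point f G x y \<longleftrightarrow> G x \<in> psd_cone \<and> y \<in> multipliers f G x"

text \<open>
  For \<open>G\<close> with values in \<open>sym_mats\<close>, the library adjoint of \<open>G'(x)\<close> is defined on all of
  \<^typ>\<open>real^'p^'p\<close>; its restriction to \<open>sym_mats\<close> is the adjoint of \<open>G'(x)\<close> as a map into \<open>S\<^sup>p\<close>.
\<close>

definition G_adj :: "(real^'n \<Rightarrow> real^'p^'p) \<Rightarrow> real^'n \<Rightarrow> real^'p^'p \<Rightarrow> real^'n" where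
  "G_adj G x = adjoint (frechet_derivative G (at x))"

definition critical_multiplier ::
  "(real^'n \<Rightarrow> real) \<Rightarrow> (real^'n \<Rightarrow> real^'p^'p) \<Rightarrow> real^'n \<Rightarrow> real^'p^'p \<Rightarrow> bool" where
  "critical_multiplier f G x y \<longleftrightarrow>
     y \<in> multipliers f G x \<and>
     (\<exists>\<xi>. \<xi> \<noteq> 0 \<and>
        0 \<in> (\<lambda>\<eta>. hessian (Lagrangian f G y) x \<xi> + G_adj G x \<eta>) `
              graphical_derivative psd_normal (G x) y (frechet_derivative G (at x) \<xi>))"

end

theory Submission
  imports Defs
begin

text \<open>
  A pair \<open>(X, Y)\<close> lies in the graph of the normal cone mapping iff \<open>X\<close> is positive semidefinite,
  \<open>Y\<close> is negative semidefinite and \<open>\<langle>X, Y\<rangle> = 0\<close>, and then \<open>X Y = 0\<close>. In an eigenbasis of \<open>X + Y\<close> both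
  matrices are diagonal. Along a sequence \<open>(X + t H\<^sub>t, Y + t K\<^sub>t)\<close> in the graph, the first-order part of
  \<open>(X + t H\<^sub>t) (Y + t K\<^sub>t) = 0\<close> gives the linear equations on the blocks, and the second-order
  part, read off in the \<open>\<beta>\<beta>\<close> block where \<open>X\<close> and \<open>Y\<close> vanish, gives \<open>(H K)\<^sub>\<beta>\<^sub>\<beta> = 0\<close>, hence the
  complementarity condition. Conversely an explicit polynomial curve in the graph has any
  \<open>(H, K)\<close> that satisfies the block conditions as its velocity.
\<close>

section \<open>Matrix algebra and the space of symmetric matrices\<close>

lemma inner_matrix_vector:
  fixes M :: "real^'p^'p"
  shows "u \<bullet> (M *v w) = (\<Sum>i\<in>UNIV. \<Sum>j\<in>UNIV. u $ i * M $ i $ j * w $ j)"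
  by (simp add: inner_vec_def matrix_vector_mult_def sum_distrib_left mult.assoc)

lemma inner_matrix:
  fixes M N :: "real^'p^'q"
  shows "M \<bullet> N = (\<Sum>i\<in>UNIV. \<Sum>j\<in>UNIV. M $ i $ j * N $ i $ j)"
  by (simp add: inner_vec_def)

lemma inner_matrix_mult_left:
  fixes A B C :: "real^'p^'p"
  shows "(A ** B) \<bullet> C = B \<bullet> (transpose A ** C)"
  by (simp add: inner_matrix_eq_trace matrix_transpose_mul matrix_mul_assoc)

lemma inner_matrix_mult_right:
  fixes A B C :: "real^'p^'p"
  shows "(A ** B) \<bullet> C = A \<bullet> (C ** transpose B)"
proof -
  have "trace (transpose B ** (transpose A ** C)) = trace ((transpose A ** C) ** transpose B)"
    by (rule trace_mul_sym)
  then show ?thesis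
    by (simp add: inner_matrix_eq_trace matrix_transpose_mul matrix_mul_assoc)
qed

lemma transpose_add: "transpose (A + B) = transpose A + transpose B"
  by (simp add: transpose_def vec_eq_iff)

lemma bounded_linear_transpose: "bounded_linear (transpose :: real^'n^'m \<Rightarrow> real^'m^'n)"
  by (rule bounded_linearI') (simp_all add: transpose_add transpose_scalar)

lemma matrix_add_rdistrib: "(A + B) ** C = A ** C + B ** C"
  by (simp add: matrix_matrix_mult_def vec_eq_iff sum.distrib distrib_right)

text \<open>In finite dimensions bilinearity already gives boundedness. The interpretation supplies
  the limit and derivative rules for matrix products.\<close>

interpretation matrix_mult:
  bounded_bilinear "(**) :: real^'n^'m \<Rightarrow> real^'p^'n \<Rightarrow> real^'p^'m"
  unfolding bilinear_conv_bounded_bilinear[symmetric] bilinear_def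
  by (intro conjI allI linearI)
     (simp_all add: matrix_add_ldistrib matrix_add_rdistrib matrix_scalar_ac
        flip: scalar_matrix_assoc)

lemma sym_matsD: "M \<in> sym_mats \<Longrightarrow> M $ i $ j = M $ j $ i"
  unfolding sym_mats_def transpose_def by (auto simp: vec_eq_iff)

lemma subspace_sym_mats: "subspace (sym_mats :: (real^'p^'p) set)"
  by (auto simp: subspace_def sym_mats_def transpose_add transpose_scalar)
     (simp add: transpose_def vec_eq_iff)

lemma closed_sym_mats: "closed (sym_mats :: (real^'p^'p) set)"
  by (intro closed_subspace subspace_sym_mats)

lemma sym_mats_congruence:
  "M \<in> sym_mats \<Longrightarrow> R ** M ** transpose R \<in> sym_mats"
  by (simp add: sym_mats_def matrix_transpose_mul matrix_mul_assoc)

section \<open>The cone of positive semidefinite matrices\<close>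

lemma psd_cone_add: "A \<in> psd_cone \<Longrightarrow> B \<in> psd_cone \<Longrightarrow> A + B \<in> psd_cone"
  using subspace_add[OF subspace_sym_mats]
  by (auto simp: psd_cone_def matrix_vector_mult_add_rdistrib inner_add_right)

lemma psd_cone_scaleR: "A \<in> psd_cone \<Longrightarrow> 0 \<le> c \<Longrightarrow> c *\<^sub>R A \<in> psd_cone"
  using subspace_scale[OF subspace_sym_mats]
  by (auto simp: psd_cone_def simp flip: scaleR_matrix_vector_assoc)

lemma zero_psd_cone: "0 \<in> psd_cone"
  using subspace_0[OF subspace_sym_mats] by (auto simp: psd_cone_def)

lemma psd_cone_congruence:
  fixes M R :: "real^'p^'p"
  assumes "M \<in> psd_cone"
  shows "R ** M ** transpose R \<in> psd_cone"
proof -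
  have "u \<bullet> ((R ** M ** transpose R) *v u) = (u v* R) \<bullet> (M *v (u v* R))" for u
    by (simp add: dot_lmul_matrix flip: matrix_vector_mul_assoc)
  then show ?thesis
    using assms sym_mats_congruence[of M R] by (simp add: psd_cone_def)
qed

lemma inner_symmetric_matrix:
  assumes "M \<in> sym_mats"
  shows "u \<bullet> (M *v w) = w \<bullet> (M *v u)"
proof -
  have "u \<bullet> (M *v w) = (u v* M) \<bullet> w" by (rule dot_lmul_matrix[symmetric])
  also have "u v* M = M *v u"
    using assms transpose_matrix_vector[of M u] by (simp add: sym_mats_def)
  finally show ?thesis by (simp add: inner_commute)
qed

text \<open>Discriminant argument: the quadratic form is nonnegative on the span of \<open>u\<close>
  and \<open>w\<close>.\<close>

lemma psd_Cauchy_Schwarz: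
  fixes Q :: "real^'p^'p"
  assumes "Q \<in> psd_cone"
  shows "(u \<bullet> (Q *v w))\<^sup>2 \<le> (u \<bullet> (Q *v u)) * (w \<bullet> (Q *v w))"
proof -
  let ?a = "u \<bullet> (Q *v u)" and ?b = "u \<bullet> (Q *v w)" and ?c = "w \<bullet> (Q *v w)"
  have sym: "Q \<in> sym_mats" and pos: "0 \<le> v \<bullet> (Q *v v)" for v
    using assms by (auto simp: psd_cone_def)
  have quad: "0 \<le> r\<^sup>2 * ?a + 2 * r * s * ?b + s\<^sup>2 * ?c" for r s
    using pos[of "r *\<^sub>R u + s *\<^sub>R w"] inner_symmetric_matrix[OF sym, of w u]
    by (simp add: algebra_simps inner_add_left inner_add_right power2_eq_square)
  show ?thesis
  proof (cases "?c = 0")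
    case True
    have "?b = 0"
    proof (rule ccontr)
      assume "?b \<noteq> 0"
      \<comment> \<open>With \<open>?c = 0\<close> and \<open>r = 1\<close> the form is affine in
        \<open>s\<close>; this \<open>s\<close> gives it the value -1.\<close>
      with quad[of 1 "- (?a + 1) / (2 * ?b)"] True pos[of u] show False
        by (simp add: field_simps)
    qed
    then show ?thesis using True by simp
  next
    case False
    then have c: "?c > 0" using pos[of w] by simp
    have "0 \<le> ?c * (?a * ?c - ?b\<^sup>2)"
      using quad[of ?c "- ?b"] by (simp add: algebra_simps power2_eq_square)
    then show ?thesis using c by (simp add: zero_le_mult_iff)
  qed
qed

text \<open>Cauchy-Schwarz with \<open>u = Q *v w\<close> bounds the fourth power of the norm of
  \<open>Q *v w\<close> by 0.\<close>

lemma psd_kernel: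
  assumes "Q \<in> psd_cone" "w \<bullet> (Q *v w) = 0"
  shows "Q *v w = 0"
  using psd_Cauchy_Schwarz[OF assms(1), of "Q *v w" w] assms(2) by simp

section \<open>Rank-one decomposition and self-duality of the cone\<close>

text \<open>The matrix w w^T: pairing it with \<open>M\<close> evaluates the quadratic form of
  \<open>M\<close> at \<open>w\<close>. Sums of such matrices exhaust the cone.\<close>

definition rank_one :: "real^'p \<Rightarrow> real^'p^'p" where
  "rank_one w = (\<chi> i j. w $ i * w $ j)"

lemma rank_one_mult_vector: "rank_one w *v u = (w \<bullet> u) *\<^sub>R w"
  by (simp add: rank_one_def matrix_vector_mult_def inner_vec_def vec_eq_iff
      sum_distrib_left mult_ac)

lemma rank_one_psd: "rank_one w \<in> psd_cone"
  by (simp add: psd_cone_def rank_one_mult_vector)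
     (simp add: sym_mats_def rank_one_def transpose_def vec_eq_iff inner_commute mult.commute)

lemma inner_rank_one: "rank_one w \<bullet> M = w \<bullet> (M *v w)"
  by (simp add: inner_matrix inner_matrix_vector rank_one_def mult_ac)

lemma rank_one_mult_eq_0:
  assumes "M \<in> sym_mats" "M *v w = 0"
  shows "rank_one w ** M = 0"
proof -
  have "(\<Sum>k\<in>UNIV. w $ k * M $ k $ j) = 0" for j
    using arg_cong[OF assms(2), of "\<lambda>v. v $ j"] sym_matsD[OF assms(1), of j]
    by (simp add: matrix_vector_mult_def mult.commute)
  then show ?thesis
    by (simp add: rank_one_def matrix_matrix_mult_def vec_eq_iff mult.assoc
        flip: sum_distrib_left)
qed

text \<open>Cholesky elimination: subtracting \<open>Z e\<^sub>i (Z e\<^sub>i)\<^sup>T / Z\<^sub>i\<^sub>i\<close> keeps \<open>Z\<close> positive semidefinite and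
  kills its \<open>i\<close>-th diagonal entry.\<close>

lemma psd_cone_induct [consumes 1, case_names zero step]:
  fixes M :: "real^'p^'p"
  assumes "M \<in> psd_cone"
    and zero: "Pr 0"
    and step: "\<And>Z w. Z \<in> psd_cone \<Longrightarrow> Pr Z \<Longrightarrow> Pr (Z + rank_one w)"
  shows "Pr M"
  using assms(1)
proof (induction "card {i. M $ i $ i \<noteq> 0}" arbitrary: M rule: less_induct)
  case less
  have entry: "axis i 1 \<bullet> (M *v axis j 1) = M $ i $ j" for i j
    by (simp add: inner_axis' matrix_vector_mult_basis column_def)
  show ?case
  proof (cases "\<exists>i. M $ i $ i \<noteq> 0")
    case False
    then have "M *v axis i 1 = 0" for i
      by (intro psd_kernel[OF less.prems]) (simp add: entry)
    then have "M $ i $ j = 0" for i j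
      using entry[of i j] by simp
    then have "M = 0" by (simp add: vec_eq_iff)
    then show ?thesis using zero by simp
  next
    case True
    then obtain i where "M $ i $ i \<noteq> 0" by blast
    have sym: "M \<in> sym_mats" and pos: "0 \<le> v \<bullet> (M *v v)" for v
      using less.prems by (auto simp: psd_cone_def)
    have Mii: "M $ i $ i > 0"
      using pos[of "axis i 1"] \<open>M $ i $ i \<noteq> 0\<close> by (simp add: entry)
    define w where "w = (1 / sqrt (M $ i $ i)) *\<^sub>R (M *v axis i 1)"
    have w: "w $ j = M $ j $ i / sqrt (M $ i $ i)" for j
      by (simp add: w_def matrix_vector_mult_basis column_def)
    define Z where "Z = M - rank_one w"
    have "u \<bullet> (Z *v u) \<ge> 0" for u
    proof -
      have "(w \<bullet> u)\<^sup>2 = (u \<bullet> (M *v axis i 1))\<^sup>2 / M $ i $ i"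
        using Mii by (simp add: w_def inner_commute power_divide)
      also have "\<dots> \<le> u \<bullet> (M *v u)"
        using psd_Cauchy_Schwarz[OF less.prems, of u "axis i 1"] Mii
        by (simp add: entry field_simps)
      finally show ?thesis
        by (simp add: Z_def matrix_vector_mult_diff_rdistrib rank_one_mult_vector inner_diff_right
            power2_eq_square inner_commute)
    qed
    moreover have "Z \<in> sym_mats"
      unfolding Z_def using sym rank_one_psd[of w] subspace_diff[OF subspace_sym_mats]
      by (auto simp: psd_cone_def)
    ultimately have Z: "Z \<in> psd_cone" by (simp add: psd_cone_def)
    have "M $ j $ j = 0 \<Longrightarrow> Z $ j $ j = 0" for j
    proof -
      assume "M $ j $ j = 0"
      then have "M *v axis j 1 = 0"
        by (intro psd_kernel[OF less.prems]) (simp add: entry)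
      then have "M $ i $ j = 0" using entry[of i j] by simp
      then show ?thesis
        using \<open>M $ j $ j = 0\<close> sym_matsD[OF sym, of i j] by (simp add: Z_def rank_one_def w)
    qed
    moreover have "Z $ i $ i = 0"
      using Mii by (simp add: Z_def rank_one_def w)
    ultimately have "{j. Z $ j $ j \<noteq> 0} \<subset> {j. M $ j $ j \<noteq> 0}"
      using Mii by fastforce
    then have "card {j. Z $ j $ j \<noteq> 0} < card {j. M $ j $ j \<noteq> 0}"
      by (intro psubset_card_mono) auto
    then have "Pr (Z + rank_one w)"
      using Z by (intro step less.hyps)
    then show ?thesis by (simp add: Z_def)
  qed
qed

text \<open>In a sum of rank-one terms each contributes a nonnegative value
  \<open>w \<bullet> (Q *v w)\<close>. If the total is 0, so is every term; then
  \<open>Q *v w = 0\<close> by \<open>psd_kernel\<close>, and each product with \<open>Q\<close>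
  vanishes.\<close>

lemma psd_cone_self_dual:
  assumes "M \<in> psd_cone" "Q \<in> psd_cone"
  shows "0 \<le> M \<bullet> Q" and "M \<bullet> Q = 0 \<Longrightarrow> M ** Q = 0"
proof -
  have "0 \<le> M \<bullet> Q \<and> (M \<bullet> Q = 0 \<longrightarrow> M ** Q = 0)"
    using assms(1)
  proof (induction rule: psd_cone_induct)
    case zero
    show ?case by simp
  next
    case (step Z w)
    have w: "0 \<le> w \<bullet> (Q *v w)" and Q: "Q \<in> sym_mats"
      using assms(2) by (auto simp: psd_cone_def)
    have eq: "(Z + rank_one w) \<bullet> Q = Z \<bullet> Q + w \<bullet> (Q *v w)"
      by (simp add: inner_add_left inner_rank_one)
    show ?case
    proof (intro conjI impI)
      show "0 \<le> (Z + rank_one w) \<bullet> Q" using eq w step.IH by simp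
      assume "(Z + rank_one w) \<bullet> Q = 0"
      then have "Z \<bullet> Q = 0" "w \<bullet> (Q *v w) = 0" using eq w step.IH by linarith+
      then show "(Z + rank_one w) ** Q = 0"
        using step.IH rank_one_mult_eq_0[OF Q psd_kernel[OF assms(2)]]
        by (simp add: matrix_add_rdistrib)
    qed
  qed
  then show "0 \<le> M \<bullet> Q" and "M \<bullet> Q = 0 \<Longrightarrow> M ** Q = 0" by auto
qed

section \<open>The graph of the normal cone mapping\<close>

text \<open>The test points 0 and 2X force orthogonality, and X + u u^T tests the sign of the form
  of \<open>Y\<close> at \<open>u\<close>. The converse is self-duality of the cone.\<close>

lemma psd_normal_iff:
  "Y \<in> psd_normal X \<longleftrightarrow> X \<in> psd_cone \<and> - Y \<in> psd_cone \<and> X \<bullet> Y = 0"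
proof
  assume Y: "Y \<in> psd_normal X"
  then have X: "X \<in> psd_cone" and Ysym: "Y \<in> sym_mats"
    and normal: "\<And>Z. Z \<in> psd_cone \<Longrightarrow> Y \<bullet> (Z - X) \<le> 0"
    by (auto simp: psd_normal_def normal_cone_def split: if_splits)
  have "Y \<bullet> X = 0"
    using normal[OF zero_psd_cone] normal[OF psd_cone_scaleR[OF X, of 2]]
    by (simp add: inner_diff_right)
  moreover have "u \<bullet> (Y *v u) \<le> 0" for u
    using normal[OF psd_cone_add[OF X rank_one_psd[of u]]] inner_rank_one[of u Y]
    by (simp add: inner_commute)
  then have "- Y \<in> psd_cone"
    using subspace_neg[OF subspace_sym_mats Ysym] matrix_vector_mult_diff_rdistrib[of 0 Y]
    by (simp add: psd_cone_def)
  ultimately show "X \<in> psd_cone \<and> - Y \<in> psd_cone \<and> X \<bullet> Y = 0"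
    using X by (simp add: inner_commute)
next
  assume *: "X \<in> psd_cone \<and> - Y \<in> psd_cone \<and> X \<bullet> Y = 0"
  then have "Y \<in> sym_mats"
    using subspace_neg[OF subspace_sym_mats, of "- Y"] by (simp add: psd_cone_def)
  moreover have "Y \<bullet> (Z - X) \<le> 0" if "Z \<in> psd_cone" for Z
    using psd_cone_self_dual(1)[OF that, of "- Y"] *
    by (simp add: inner_diff_right inner_commute)
  ultimately show "Y \<in> psd_normal X"
    using * by (simp add: psd_normal_def normal_cone_def)
qed

section \<open>Tangent cones under orthogonal congruence\<close>

lemma tangent_cone_linear_image:
  assumes L: "bounded_linear L" and "L ` \<Omega> \<subseteq> \<Omega>'" and "w \<in> tangent_cone z \<Omega>"
  shows "L w \<in> tangent_cone (L z) \<Omega>'"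
proof -
  interpret bounded_linear L by (rule L)
  obtain t ws where t: "\<forall>k. 0 < t k" "t \<longlonglongrightarrow> 0" "ws \<longlonglongrightarrow> w"
    and ws: "\<forall>k. ws k \<in> (\<lambda>s. (s - z) /\<^sub>R t k) ` \<Omega>"
    using assms(3) unfolding tangent_cone_def by blast
  have "(\<lambda>k. L (ws k)) \<longlonglongrightarrow> L w" by (rule tendsto[OF t(3)])
  moreover have "L (ws k) \<in> (\<lambda>s. (s - L z) /\<^sub>R t k) ` \<Omega>'" for k
    using ws[rule_format, of k] assms(2) by (auto simp: scaleR diff intro!: imageI)
  ultimately show ?thesis
    unfolding tangent_cone_def using t by blast
qed

lemma congruence_inverse:
  fixes P M :: "real^'p^'p"
  assumes "transpose P ** P = mat 1"
  shows "transpose P ** (P ** M ** transpose P) ** P = M"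
proof -
  have "transpose P ** (P ** M ** transpose P) ** P =
      (transpose P ** P) ** M ** (transpose P ** P)"
    by (simp only: matrix_mul_assoc)
  then show ?thesis using assms by simp
qed

lemma gph_psd_normal_congruence:
  fixes P :: "real^'p^'p"
  assumes P: "orthogonal_matrix P" and "(X, Y) \<in> gph psd_normal"
  shows "(transpose P ** X ** P, transpose P ** Y ** P) \<in> gph psd_normal"
proof -
  have PP: "P ** transpose P = mat 1" using P by (simp add: orthogonal_matrix_def)
  have "(transpose P ** X ** P) \<bullet> (transpose P ** Y ** P) =
      X \<bullet> (P ** (transpose P ** Y ** P) ** transpose P)"
    by (simp only: inner_matrix_mult_right[of "transpose P ** X" P]
        inner_matrix_mult_left[of "transpose P" X] transpose_transpose matrix_mul_assoc)
  also have "\<dots> = X \<bullet> Y"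
    using congruence_inverse[of "transpose P" Y] PP by simp
  finally have "(transpose P ** X ** P) \<bullet> (transpose P ** Y ** P) = X \<bullet> Y" .
  moreover have "- (transpose P ** Y ** P) = transpose P ** (- Y) ** P"
    by (simp add: matrix_mult.minus_left matrix_mult.minus_right)
  ultimately show ?thesis
    using assms(2) psd_cone_congruence[of _ "transpose P"] by (simp add: gph_def psd_normal_iff)
qed

text \<open>The congruence is linear and maps the graph into itself, so it carries tangent vectors
  to tangent vectors. Applied to \<open>transpose P\<close>, the lemma gives the reverse
  inclusion.\<close>

lemma graphical_derivative_psd_normal_congruence:
  fixes P :: "real^'p^'p"
  assumes "orthogonal_matrix P" and "K \<in> graphical_derivative psd_normal X Y H"
  shows "transpose P ** K ** P \<in> graphical_derivative psd_normal
    (transpose P ** X ** P) (transpose P ** Y ** P) (transpose P ** H ** P)"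
proof -
  define L where "L = (\<lambda>(A, B). (transpose P ** A ** P, transpose P ** B ** P))"
  have C: "bounded_linear (\<lambda>A. transpose P ** A ** P)"
    using bounded_linear_compose[OF matrix_mult.bounded_linear_left[of P]
        matrix_mult.bounded_linear_right[of "transpose P"]] .
  have "bounded_linear L"
    unfolding L_def split_def
    using bounded_linear_Pair[OF bounded_linear_compose[OF C bounded_linear_fst]
        bounded_linear_compose[OF C bounded_linear_snd]] .
  moreover have "L ` gph psd_normal \<subseteq> gph psd_normal"
  proof
    fix z assume "z \<in> L ` gph psd_normal"
    then obtain A B where z: "z = L (A, B)" and AB: "(A, B) \<in> gph psd_normal" by auto
    have "(transpose P ** A ** P, transpose P ** B ** P) \<in> gph psd_normal"
      by (rule gph_psd_normal_congruence[OF assms(1) AB])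
    then show "z \<in> gph psd_normal" by (simp only: z L_def prod.case)
  qed
  ultimately have "L (H, K) \<in> tangent_cone (L (X, Y)) (gph psd_normal)"
    using assms(2) unfolding graphical_derivative_def mem_Collect_eq
    by (rule tangent_cone_linear_image)
  then show ?thesis by (simp only: graphical_derivative_def L_def prod.case mem_Collect_eq)
qed

section \<open>Diagonal form of a pair in the graph\<close>

lemma diag_mat_quadratic_form: "u \<bullet> (diag_mat d *v u) = (\<Sum>i\<in>UNIV. d $ i * (u $ i)\<^sup>2)"
  by (simp add: inner_matrix_vector diag_mat_def power2_eq_square if_distrib if_distribR
      mult_ac cong: if_cong)

lemma diag_mat_sym: "diag_mat d \<in> sym_mats"
  by (auto simp: sym_mats_def diag_mat_def transpose_def vec_eq_iff)

lemma diag_mat_psd: "(\<And>i. 0 \<le> d $ i) \<Longrightarrow> diag_mat d \<in> psd_cone"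
  by (simp add: psd_cone_def diag_mat_sym diag_mat_quadratic_form sum_nonneg)

text \<open>The splitting of a symmetric matrix into mutually orthogonal positive and negative
  semidefinite parts is unique, and the positive and negative parts of the eigenvalues give one such
  splitting.\<close>

lemma psd_normal_of_diag:
  fixes X Y P :: "real^'p^'p"
  assumes "Y \<in> psd_normal X" "orthogonal_matrix P"
    and A: "X + Y = P ** diag_mat lam ** transpose P"
  shows "transpose P ** X ** P = diag_mat (\<chi> i. max (lam $ i) 0)"
    and "transpose P ** Y ** P = diag_mat (\<chi> i. min (lam $ i) 0)"
proof -
  let ?X = "transpose P ** X ** P" and ?Y = "transpose P ** Y ** P"
  let ?D = "diag_mat (\<chi> i. max (lam $ i) 0)" and ?E = "diag_mat (\<chi> i. min (lam $ i) 0)"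
  have XY: "?X \<in> psd_cone" "- ?Y \<in> psd_cone" "?X \<bullet> ?Y = 0"
    using gph_psd_normal_congruence[OF assms(2), of X Y] assms(1)
    by (auto simp: gph_def psd_normal_iff)
  have minus: "- ?E = diag_mat (\<chi> i. - min (lam $ i) 0)"
    by (simp add: diag_mat_def vec_eq_iff)
  have DE: "?D \<in> psd_cone" "- ?E \<in> psd_cone" "?D \<bullet> ?E = 0"
    unfolding minus by (auto intro!: diag_mat_psd)
      (auto simp: inner_matrix diag_mat_def max_def min_def intro!: sum.neutral)
  have "?X + ?Y = transpose P ** (X + Y) ** P"
    by (simp add: matrix_add_ldistrib matrix_add_rdistrib)
  also have "\<dots> = diag_mat lam"
    unfolding A using assms(2) by (intro congruence_inverse) (simp add: orthogonal_matrix_def)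
  also have "\<dots> = ?D + ?E"
    by (auto simp: diag_mat_def vec_eq_iff max_def min_def)
  finally have sum: "?X + ?Y = ?D + ?E" .
  \<comment> \<open>This product is nonnegative by self-duality, while equality of the two sums
    makes it minus a squared norm.\<close>
  have "(?X - ?D) \<bullet> (?Y - ?E) = ?X \<bullet> (- ?E) + ?D \<bullet> (- ?Y)"
    using XY(3) DE(3) by (simp add: inner_simps)
  then have "0 \<le> (?X - ?D) \<bullet> (?Y - ?E)"
    using psd_cone_self_dual(1)[OF XY(1) DE(2)] psd_cone_self_dual(1)[OF DE(1) XY(2)] by simp
  moreover have YE: "?Y - ?E = - (?X - ?D)" using sum by (simp add: algebra_simps)
  ultimately have "(?X - ?D) \<bullet> (?X - ?D) \<le> 0"
    by (simp only: inner_minus_right neg_0_le_iff_le)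
  then have "?X - ?D = 0" using inner_gt_zero_iff not_less by blast
  moreover from this have "?Y - ?E = 0" unfolding YE by (simp only: minus_zero)
  ultimately show "?X = ?D" and "?Y = ?E" by (simp_all only: right_minus_eq)
qed

lemma diag_mat_mult_entry: "(diag_mat d ** M) $ i $ j = d $ i * M $ i $ j"
  by (simp add: matrix_matrix_mult_def diag_mat_def if_distrib if_distribR cong: if_cong)

lemma mult_diag_mat_entry: "(M ** diag_mat d) $ i $ j = M $ i $ j * d $ j"
  by (simp add: matrix_matrix_mult_def diag_mat_def if_distrib if_distribR cong: if_cong)

section \<open>Necessity of the block conditions at a diagonal pair\<close>

text \<open>The \<alpha>\<gamma> condition has the denominator of \<Sigma> cleared, the form that
  the linearised product delivers; \<open>Sigma_mat_mixed\<close> translates it.\<close>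

definition derivative_blocks :: "real^'p \<Rightarrow> real^'p^'p \<Rightarrow> real^'p^'p \<Rightarrow> bool" where
  "derivative_blocks lam H K \<longleftrightarrow>
    (\<forall>i j. lam $ i = 0 \<longrightarrow> lam $ j < 0 \<longrightarrow> H $ i $ j = 0) \<and>
    (\<forall>i j. lam $ i < 0 \<longrightarrow> lam $ j < 0 \<longrightarrow> H $ i $ j = 0) \<and>
    (\<forall>i j. 0 < lam $ i \<longrightarrow> 0 < lam $ j \<longrightarrow> K $ i $ j = 0) \<and>
    (\<forall>i j. 0 < lam $ i \<longrightarrow> lam $ j = 0 \<longrightarrow> K $ i $ j = 0) \<and>
    (\<forall>i j. 0 < lam $ i \<longrightarrow> lam $ j < 0 \<longrightarrow> lam $ j * H $ i $ j + lam $ i * K $ i $ j = 0) \<and>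
    psd_block {i. lam $ i = 0} H \<and> nsd_block {i. lam $ i = 0} K \<and>
    inner_block {i. lam $ i = 0} H K = 0"

text \<open>Extension of the vector by zero lets the form on a block be tested through the full
  matrix.\<close>

lemma block_form_eq:
  fixes M :: "real^'p^'p"
  shows "(\<Sum>i\<in>I. \<Sum>j\<in>I. u i * M $ i $ j * u j) =
    (\<chi> i. if i \<in> I then u i else 0) \<bullet> (M *v (\<chi> i. if i \<in> I then u i else 0))"
proof -
  let ?u = "\<chi> i. if i \<in> I then u i else 0"
  have "(\<Sum>j\<in>I. u i * M $ i $ j * u j) = (\<Sum>j\<in>UNIV. ?u $ i * M $ i $ j * ?u $ j)"
    if "i \<in> I" for i
    using that by (intro sum.mono_neutral_cong_left) auto
  then show ?thesis
    unfolding inner_matrix_vector by (intro sum.mono_neutral_cong_left) auto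
qed

lemma derivative_blocks_necessary:
  fixes H K :: "real^'p^'p"
  assumes "K \<in> graphical_derivative psd_normal (diag_mat (\<chi> i. max (lam $ i) 0))
    (diag_mat (\<chi> i. min (lam $ i) 0)) H"
  shows "K \<in> sym_mats" and "derivative_blocks lam H K"
proof -
  let ?D = "diag_mat (\<chi> i. max (lam $ i) 0) :: real^'p^'p"
  let ?E = "diag_mat (\<chi> i. min (lam $ i) 0) :: real^'p^'p"
  obtain t ws where t: "\<And>k::nat. 0 < t k" "t \<longlonglongrightarrow> 0" and ws: "ws \<longlonglongrightarrow> (H, K)"
    and img: "\<And>k. ws k \<in> (\<lambda>s. (s - (?D, ?E)) /\<^sub>R t k) ` gph psd_normal"
    using assms unfolding graphical_derivative_def tangent_cone_def by blast
  define h where "h k = fst (ws k)" for k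
  define c where "c k = snd (ws k)" for k
  have h: "h \<longlonglongrightarrow> H" and c: "c \<longlonglongrightarrow> K"
    unfolding h_def c_def using tendsto_fst[OF ws] tendsto_snd[OF ws] by simp_all
  have gph: "?D + t k *\<^sub>R h k \<in> psd_cone" "- (?E + t k *\<^sub>R c k) \<in> psd_cone"
    "(?D + t k *\<^sub>R h k) \<bullet> (?E + t k *\<^sub>R c k) = 0" for k
  proof -
    obtain X Y where "(X, Y) \<in> gph psd_normal" "ws k = ((X, Y) - (?D, ?E)) /\<^sub>R t k"
      using img[of k] by auto
    moreover from this have "?D + t k *\<^sub>R h k = X" "?E + t k *\<^sub>R c k = Y"
      using t(1)[of k] by (simp_all add: h_def c_def)
    ultimately show "?D + t k *\<^sub>R h k \<in> psd_cone" "- (?E + t k *\<^sub>R c k) \<in> psd_cone"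
      "(?D + t k *\<^sub>R h k) \<bullet> (?E + t k *\<^sub>R c k) = 0"
      by (simp_all add: gph_def psd_normal_iff)
  qed
  \<comment> \<open>Self-duality upgrades the scalar orthogonality to a matrix equation whose
    entries can be read separately.\<close>
  have prod: "(?D + t k *\<^sub>R h k) ** (?E + t k *\<^sub>R c k) = 0" for k
  proof -
    have "(?D + t k *\<^sub>R h k) ** (- (?E + t k *\<^sub>R c k)) = 0"
      by (rule psd_cone_self_dual(2)[OF gph(1,2)]) (simp only: inner_minus_right gph(3) minus_zero)
    then show ?thesis by (simp only: matrix_mult.minus_right neg_equal_0_iff_equal)
  qed
  have DE: "?D ** ?E = 0"
    by (simp add: vec_eq_iff diag_mat_mult_entry) (simp add: diag_mat_def max_def min_def)
  \<comment> \<open>Since \<open>?D ** ?E = 0\<close>, one factor \<open>t k\<close> divides out.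
    The remaining multiple of \<open>h k ** c k\<close> carries the second-order
    information.\<close>
  have scaled: "h k ** ?E + ?D ** c k + t k *\<^sub>R (h k ** c k) = 0" for k
  proof -
    have "t k *\<^sub>R (h k ** ?E + ?D ** c k + t k *\<^sub>R (h k ** c k)) = 0"
      using prod[of k] DE
      by (simp add: matrix_mult.add_left matrix_mult.add_right matrix_mult.scaleR_left
          matrix_mult.scaleR_right scaleR_add_right add_ac)
    then show ?thesis using t(1)[of k] by simp
  qed
  have "(\<lambda>k. h k ** ?E + ?D ** c k + t k *\<^sub>R (h k ** c k)) \<longlonglongrightarrow> H ** ?E + ?D ** K + 0 *\<^sub>R (H ** K)"
    by (intro tendsto_intros matrix_mult.tendsto h c t)
  then have first_order: "H ** ?E + ?D ** K = 0"
    unfolding scaled by (simp add: LIMSEQ_const_iff)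
  have lin: "H $ i $ j * min (lam $ j) 0 + max (lam $ i) 0 * K $ i $ j = 0" for i j
    using arg_cong[OF first_order, of "\<lambda>M. M $ i $ j"]
    by (simp add: diag_mat_mult_entry mult_diag_mat_entry)
  have symH: "H \<in> sym_mats" and symK: "K \<in> sym_mats"
  proof -
    have sym_t: "M \<in> sym_mats" if "t k *\<^sub>R M \<in> sym_mats" for M :: "real^'p^'p" and k
      using subspace_scale[OF subspace_sym_mats that, of "1 / t k"] t(1)[of k] by simp
    have "h k \<in> sym_mats" for k
    proof (rule sym_t)
      have "?D + t k *\<^sub>R h k \<in> sym_mats" using gph(1)[of k] by (simp add: psd_cone_def)
      from subspace_diff[OF subspace_sym_mats this diag_mat_sym[of "\<chi> i. max (lam $ i) 0"]]
      show "t k *\<^sub>R h k \<in> sym_mats" by simp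
    qed
    then show "H \<in> sym_mats" by (intro closed_sequentially[OF closed_sym_mats _ h])
    have "c k \<in> sym_mats" for k
    proof (rule sym_t)
      have "- (?E + t k *\<^sub>R c k) \<in> sym_mats" using gph(2)[of k] by (simp add: psd_cone_def)
      from subspace_add[OF subspace_sym_mats this diag_mat_sym[of "\<chi> i. min (lam $ i) 0"]]
      have "- (t k *\<^sub>R c k) \<in> sym_mats" by simp
      from subspace_neg[OF subspace_sym_mats this] show "t k *\<^sub>R c k \<in> sym_mats" by simp
    qed
    then show "K \<in> sym_mats" by (intro closed_sequentially[OF closed_sym_mats _ c])
  qed
  let ?\<beta> = "{i. lam $ i = 0}"
  \<comment> \<open>The diagonal base point is invisible to vectors supported on \<beta>, so the
    sign of the perturbed form is the sign of the perturbation there.\<close>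
  have restr: "(\<chi> i. if lam $ i = 0 then u i else 0) \<bullet>
      ((diag_mat d + M) *v (\<chi> i. if lam $ i = 0 then u i else 0))
    = (\<chi> i. if lam $ i = 0 then u i else 0) \<bullet> (M *v (\<chi> i. if lam $ i = 0 then u i else 0))"
    if "\<And>i. lam $ i = 0 \<Longrightarrow> d $ i = 0" for u d and M :: "real^'p^'p"
    by (simp add: matrix_vector_mult_add_rdistrib inner_add_right diag_mat_quadratic_form
        that sum.neutral)
  have psdH: "psd_block ?\<beta> H"
    unfolding psd_block_def
  proof (intro conjI ballI allI)
    fix u :: "'p \<Rightarrow> real"
    let ?u = "\<chi> i. if lam $ i = 0 then u i else 0"
    have "0 \<le> ?u \<bullet> (h k *v ?u)" for k
    proof -
      have "0 \<le> ?u \<bullet> ((?D + t k *\<^sub>R h k) *v ?u)" using gph(1)[of k] by (simp add: psd_cone_def)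
      then have "0 \<le> t k * (?u \<bullet> (h k *v ?u))"
        by (simp add: restr flip: scaleR_matrix_vector_assoc)
      then show ?thesis using t(1)[of k] by (simp add: zero_le_mult_iff)
    qed
    moreover have "(\<lambda>k. ?u \<bullet> (h k *v ?u)) \<longlonglongrightarrow> ?u \<bullet> (H *v ?u)"
      unfolding inner_matrix_vector by (intro tendsto_intros h)
    ultimately have "0 \<le> ?u \<bullet> (H *v ?u)" by (intro LIMSEQ_le_const) auto
    then show "0 \<le> (\<Sum>i\<in>?\<beta>. \<Sum>j\<in>?\<beta>. u i * H $ i $ j * u j)"
      unfolding block_form_eq by simp
  qed (simp add: sym_matsD[OF symH])
  have nsdK: "nsd_block ?\<beta> K"
    unfolding nsd_block_def
  proof (intro conjI ballI allI)
    fix u :: "'p \<Rightarrow> real"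
    let ?u = "\<chi> i. if lam $ i = 0 then u i else 0"
    have "?u \<bullet> (c k *v ?u) \<le> 0" for k
    proof -
      have "0 \<le> ?u \<bullet> ((- (?E + t k *\<^sub>R c k)) *v ?u)"
        using gph(2)[of k] by (simp add: psd_cone_def)
      then have "?u \<bullet> ((?E + t k *\<^sub>R c k) *v ?u) \<le> 0"
        using matrix_vector_mult_diff_rdistrib[of 0 "?E + t k *\<^sub>R c k" ?u] by simp
      then have "t k * (?u \<bullet> (c k *v ?u)) \<le> 0"
        by (simp add: restr flip: scaleR_matrix_vector_assoc)
      then show ?thesis using t(1)[of k] by (simp add: mult_le_0_iff)
    qed
    moreover have "(\<lambda>k. ?u \<bullet> (c k *v ?u)) \<longlonglongrightarrow> ?u \<bullet> (K *v ?u)"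
      unfolding inner_matrix_vector by (intro tendsto_intros c)
    ultimately have "?u \<bullet> (K *v ?u) \<le> 0" by (intro LIMSEQ_le_const2) auto
    then show "(\<Sum>i\<in>?\<beta>. \<Sum>j\<in>?\<beta>. u i * K $ i $ j * u j) \<le> 0"
      unfolding block_form_eq by simp
  qed (simp add: sym_matsD[OF symK])
  have Kpos: "K $ i $ j = 0" if "0 < lam $ i" "0 \<le> lam $ j" for i j
  proof -
    have "max (lam $ i) 0 = lam $ i" "min (lam $ j) 0 = 0" using that by auto
    then show ?thesis using lin[of i j] that by simp
  qed
  have Hneg: "H $ i $ j = 0" if "lam $ i \<le> 0" "lam $ j < 0" for i j
  proof -
    have "max (lam $ i) 0 = 0" "min (lam $ j) 0 = lam $ j" using that by auto
    then show ?thesis using lin[of i j] that by simp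
  qed
  have mixed: "lam $ j * H $ i $ j + lam $ i * K $ i $ j = 0" if "0 < lam $ i" "lam $ j < 0" for i j
  proof -
    have "max (lam $ i) 0 = lam $ i" "min (lam $ j) 0 = lam $ j" using that by auto
    then show ?thesis using lin[of i j] by (simp add: mult.commute)
  qed
  \<comment> \<open>On \<beta>\<beta> both first-order terms in \<open>scaled\<close> are exactly
    zero for every \<open>k\<close>, so the entry of \<open>h k ** c k\<close> vanishes before the
    limit is taken.\<close>
  have HK: "(H ** K) $ i $ j = 0" if "lam $ i = 0" "lam $ j = 0" for i j
  proof -
    have "(h k ** c k) $ i $ j = 0" for k
      using arg_cong[OF scaled[of k], of "\<lambda>M. M $ i $ j"] that t(1)[of k]
      by (simp add: diag_mat_mult_entry mult_diag_mat_entry)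
    moreover have "(\<lambda>k. (h k ** c k) $ i $ j) \<longlonglongrightarrow> (H ** K) $ i $ j"
      by (intro tendsto_intros matrix_mult.tendsto h c)
    ultimately show ?thesis by (simp add: LIMSEQ_const_iff)
  qed
  \<comment> \<open>The sum over \<beta> may run over all indices: \<open>K\<close> kills the terms
    with j in \<alpha> and \<open>H\<close> those with j in \<gamma>. What results is a diagonal
    entry of \<open>H ** K\<close>.\<close>
  have row: "(\<Sum>j\<in>?\<beta>. H $ i $ j * K $ i $ j) = 0" if "lam $ i = 0" for i
  proof -
    have "(\<Sum>j\<in>?\<beta>. H $ i $ j * K $ i $ j) = (\<Sum>j\<in>?\<beta>. H $ i $ j * K $ j $ i)"
      using sym_matsD[OF symK] by (intro sum.cong) auto
    also have "\<dots> = (\<Sum>j\<in>UNIV. H $ i $ j * K $ j $ i)"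
      using that Kpos[of _ i] Hneg[of i] by (intro sum.mono_neutral_left) (auto simp: neq_iff)
    also have "\<dots> = 0" using HK[OF that that] by (simp add: matrix_matrix_mult_def)
    finally show ?thesis .
  qed
  show "K \<in> sym_mats" by (rule symK)
  have "inner_block ?\<beta> H K = 0"
    unfolding inner_block_def by (rule sum.neutral) (simp add: row)
  then show "derivative_blocks lam H K"
    unfolding derivative_blocks_def using psdH nsdK Kpos Hneg mixed by simp
qed

section \<open>Sufficiency of the block conditions by curves in the graph\<close>

text \<open>The difference quotients of both curves at the times 1 / (k + 1) form the sequence that
  the tangent cone asks for.\<close>

lemma graphical_derivative_curve:
  fixes Z :: "real \<Rightarrow> 'a::real_normed_vector" and V :: "real \<Rightarrow> 'b::real_normed_vector"
  assumes "(Z has_vector_derivative H) (at 0)" "(V has_vector_derivative K) (at 0)"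
    and "\<And>t. 0 < t \<Longrightarrow> V t \<in> F (Z t)"
  shows "K \<in> graphical_derivative F (Z 0) (V 0) H"
proof -
  let ?t = "\<lambda>k::nat. 1 / real (Suc k)"
  let ?w = "\<lambda>k. ((Z (?t k), V (?t k)) - (Z 0, V 0)) /\<^sub>R ?t k"
  have t: "?t \<longlonglongrightarrow> 0" by (rule LIMSEQ_Suc[OF lim_1_over_n])
  have at0: "filterlim ?t (at 0) sequentially"
    using t by (auto simp: filterlim_at intro!: eventuallyI)
  have quotient: "(\<lambda>k. (W (?t k) - W 0) /\<^sub>R ?t k) \<longlonglongrightarrow> D"
    if "(W has_vector_derivative D) (at 0)" for W :: "real \<Rightarrow> 'c::real_normed_vector" and D
  proof -
    have "((\<lambda>s. norm (W s - W 0 - s *\<^sub>R D) / norm s) \<longlongrightarrow> 0) (at 0)"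
      using that by (simp add: has_vector_derivative_def has_derivative_iff_norm)
    moreover have "norm (W s - W 0 - s *\<^sub>R D) / norm s = norm ((W s - W 0) /\<^sub>R s - D)"
      if "s \<noteq> 0" for s
    proof -
      have "(W s - W 0) /\<^sub>R s - D = (W s - W 0 - s *\<^sub>R D) /\<^sub>R s"
        using that by (simp add: scaleR_diff_right)
      then show ?thesis by (simp add: divide_inverse)
    qed
    then have "eventually (\<lambda>s. norm (W s - W 0 - s *\<^sub>R D) / norm s =
        norm ((W s - W 0) /\<^sub>R s - D)) (at 0)"
      by (simp add: eventually_at_filter)
    ultimately have "((\<lambda>s. norm ((W s - W 0) /\<^sub>R s - D)) \<longlongrightarrow> 0) (at 0)"
      by (rule Lim_transform_eventually)
    then have "((\<lambda>s. (W s - W 0) /\<^sub>R s) \<longlongrightarrow> D) (at 0)"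
      by (rule LIM_zero_cancel[OF tendsto_norm_zero_cancel])
    from filterlim_compose[OF this at0] show ?thesis .
  qed
  have "?w \<longlonglongrightarrow> (H, K)"
    using tendsto_Pair[OF quotient[OF assms(1)] quotient[OF assms(2)]] by (simp add: scaleR_Pair)
  moreover have "?w k \<in> (\<lambda>s. (s - (Z 0, V 0)) /\<^sub>R ?t k) ` gph F" for k
    using assms(3)[of "?t k"] by (intro imageI) (simp add: gph_def)
  ultimately show ?thesis
    unfolding graphical_derivative_def tangent_cone_def mem_Collect_eq
    using t by (intro exI[of _ ?t] exI[of _ ?w]) auto
qed

text \<open>Padding with zeros keeps the quadratic form of the block, so the padded block can be
  added to a diagonal matrix inside the cone.\<close>

lemma block_psd:
  fixes M :: "real^'p^'p"
  assumes "psd_block I M"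
  shows "(\<chi> i j. if i \<in> I \<and> j \<in> I then M $ i $ j else 0) \<in> psd_cone" (is "?B \<in> _")
proof -
  have form: "(\<Sum>i\<in>I. \<Sum>j\<in>I. u $ i * M $ i $ j * u $ j) = u \<bullet> (?B *v u)" for u
  proof -
    have "(\<Sum>j\<in>I. u $ i * M $ i $ j * u $ j) = (\<Sum>j\<in>UNIV. u $ i * ?B $ i $ j * u $ j)"
      if "i \<in> I" for i
      using that by (intro sum.mono_neutral_cong_left) auto
    then show ?thesis
      unfolding inner_matrix_vector by (intro sum.mono_neutral_cong_left) auto
  qed
  have "0 \<le> u \<bullet> (?B *v u)" for u
    unfolding form[symmetric] using assms by (simp only: psd_block_def)
  moreover have "?B \<in> sym_mats"
    using assms by (auto simp: psd_block_def sym_mats_def transpose_def vec_eq_iff)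
  ultimately show ?thesis by (simp add: psd_cone_def)
qed

lemma nsd_block_iff_psd_block: "nsd_block I M \<longleftrightarrow> psd_block I (- M)"
  by (simp add: nsd_block_def psd_block_def sum_negf)

lemma congruence_has_vector_derivative:
  fixes F M :: "real \<Rightarrow> real^'p^'p"
  assumes "(F has_vector_derivative F') (at t)" "(M has_vector_derivative M') (at t)"
  shows "((\<lambda>t. F t ** M t ** transpose (F t)) has_vector_derivative
    F t ** M t ** transpose F' + (F t ** M' + F' ** M t) ** transpose (F t)) (at t)"
  by (rule matrix_mult.has_vector_derivative[OF matrix_mult.has_vector_derivative[OF assms]
        bounded_linear.has_vector_derivative[OF bounded_linear_transpose assms(1)]])

lemma affine_has_vector_derivative: "((\<lambda>t. A + t *\<^sub>R B) has_vector_derivative B) (at t)"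
  by (auto intro!: derivative_eq_intros)

text \<open>The curve through \<open>(X, Y)\<close> realising \<open>(H, K)\<close>: with \<open>H\<^sub>\<beta>\<^sub>\<beta>\<close>, \<open>K\<^sub>\<beta>\<^sub>\<beta>\<close> placed on the middle
  block, transform \<open>X + t H\<^sub>\<beta>\<^sub>\<beta>\<close> by \<open>R = I + t W\<close> and \<open>Y + t K\<^sub>\<beta>\<^sub>\<beta>\<close> by \<open>R\<^sup>-\<^sup>T\<close>, which preserves
  the signs and the inner product. \<open>W\<close> is strictly block triangular, so that \<open>W\<^sup>3 = 0\<close> and
  \<open>R\<^sup>-\<^sup>1 = I - t W + t\<^sup>2 W\<^sup>2\<close>. The blocks \<open>H\<^sub>\<alpha>\<^sub>\<alpha>\<close> and \<open>K\<^sub>\<gamma>\<^sub>\<gamma>\<close> are produced by the additional factors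
  \<open>I + t V\<close> and \<open>I + t U\<close>, each of which is invisible to the other matrix.\<close>

lemma derivative_blocks_sufficient:
  fixes H K :: "real^'p^'p"
  assumes blocks: "derivative_blocks lam H K" and symH: "H \<in> sym_mats" and symK: "K \<in> sym_mats"
  shows "K \<in> graphical_derivative psd_normal (diag_mat (\<chi> i. max (lam $ i) 0))
    (diag_mat (\<chi> i. min (lam $ i) 0)) H"
proof -
  let ?D = "diag_mat (\<chi> i. max (lam $ i) 0) :: real^'p^'p"
  let ?E = "diag_mat (\<chi> i. min (lam $ i) 0) :: real^'p^'p"
  let ?\<beta> = "{i. lam $ i = 0}"
  have Hneg: "\<And>i j. lam $ i = 0 \<Longrightarrow> lam $ j < 0 \<Longrightarrow> H $ i $ j = 0"
      "\<And>i j. lam $ i < 0 \<Longrightarrow> lam $ j < 0 \<Longrightarrow> H $ i $ j = 0"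
    and Kpos: "\<And>i j. 0 < lam $ i \<Longrightarrow> 0 < lam $ j \<Longrightarrow> K $ i $ j = 0"
      "\<And>i j. 0 < lam $ i \<Longrightarrow> lam $ j = 0 \<Longrightarrow> K $ i $ j = 0"
    and mixed: "\<And>i j. 0 < lam $ i \<Longrightarrow> lam $ j < 0 \<Longrightarrow> lam $ j * H $ i $ j + lam $ i * K $ i $ j = 0"
    and psd: "psd_block ?\<beta> H" "psd_block ?\<beta> (- K)" "inner_block ?\<beta> H K = 0"
    using blocks unfolding derivative_blocks_def nsd_block_iff_psd_block by blast+
  define B where "B = (\<lambda>M::real^'p^'p. \<chi> i j. if lam $ i = 0 \<and> lam $ j = 0 then M $ i $ j else 0)"
  \<comment> \<open>The factor 1/2 is there because \<open>V\<close> and its transpose contribute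
    equally to \<alpha>\<alpha>; likewise \<open>U\<close> on \<gamma>\<gamma>.\<close>
  define V where "V = (\<chi> i j. if 0 < lam $ i \<and> 0 < lam $ j then H $ i $ j / (2 * lam $ j) else 0)"
  define U where "U = (\<chi> i j. if lam $ i < 0 \<and> lam $ j < 0 then K $ i $ j / (2 * lam $ j) else 0)"
  \<comment> \<open>The first case makes \<open>W ** ?D\<close> reproduce \<open>H\<close> in rows
    of \<beta> and \<gamma> and columns of \<alpha>; the second makes the velocity of the other
    curve reproduce \<open>K\<close> on \<beta>\<gamma>. On \<alpha>\<gamma> the value of
    \<open>K\<close> is then forced by \<open>mixed\<close>.\<close>
  define W where "W = (\<chi> i j. if 0 < lam $ j \<and> lam $ i \<le> 0 then H $ i $ j / lam $ j
      else if lam $ i < 0 \<and> lam $ j = 0 then - K $ i $ j / lam $ i else 0)"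
  define R where "R t = mat 1 + t *\<^sub>R W" for t
  define S where "S t = mat 1 + t *\<^sub>R (- W + t *\<^sub>R (W ** W))" for t
  define F where "F t = R t ** (mat 1 + t *\<^sub>R V)" for t
  define J where "J t = transpose (S t) ** (mat 1 + t *\<^sub>R U)" for t
  define X0 where "X0 t = ?D + t *\<^sub>R B H" for t
  define Y0 where "Y0 t = ?E + t *\<^sub>R B K" for t

  have "W ** W ** W = 0"
  proof -
    \<comment> \<open>A nonzero entry of \<open>W\<close> has its column in a strictly higher sign
      class than its row. Three consecutive moves would need four classes.\<close>
    have "W $ i $ k * W $ k $ l * W $ l $ j = 0" for i j k l
      by (auto simp: W_def)
    then have "(\<Sum>l\<in>UNIV. \<Sum>k\<in>UNIV. W $ i $ k * W $ k $ l * W $ l $ j) = 0" for i j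
      by (simp only: sum.neutral_const)
    then show ?thesis
      by (simp only: matrix_matrix_mult_def vec_eq_iff vec_lambda_beta sum_distrib_right
          zero_index simp_thms)
  qed
  \<comment> \<open>The product telescopes to I + t^3 W^3.\<close>
  then have SR: "S t ** R t = mat 1" for t
    by (simp add: S_def R_def matrix_mult.add_left matrix_mult.add_right matrix_mult.scaleR_left
        matrix_mult.scaleR_right matrix_mult.diff_left scaleR_diff_right)

  \<comment> \<open>\<open>R\<close> and \<open>S\<close> cancel, leaving I + t U + t V^T.
    \<open>U\<close> has no entries in rows with \<open>lam $ i\<close> nonnegative, and V^T has
    none in columns with \<open>lam $ l\<close> nonpositive.\<close>
  have N: "(transpose (F t) ** J t) $ i $ l = mat 1 $ i $ l"
    if "0 \<le> lam $ i" "lam $ l \<le> 0" for t i l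
  proof -
    have "transpose (F t) ** J t =
        transpose (mat 1 + t *\<^sub>R V) ** transpose (S t ** R t) ** (mat 1 + t *\<^sub>R U)"
      by (simp only: F_def J_def matrix_transpose_mul matrix_mul_assoc)
    also have "\<dots> = mat 1 + t *\<^sub>R U + t *\<^sub>R transpose V + t *\<^sub>R t *\<^sub>R (transpose V ** U)"
      by (simp add: SR transpose_add transpose_scalar matrix_mult.add_left matrix_mult.add_right
          matrix_mult.scaleR_left matrix_mult.scaleR_right scaleR_add_right)
    also have "transpose V ** U = 0"
      by (auto simp: matrix_matrix_mult_def transpose_def V_def U_def vec_eq_iff intro!: sum.neutral)
    finally show ?thesis
      using that by (simp add: transpose_def V_def U_def)
  qed

  \<comment> \<open>\<open>X0 t\<close> lives on \<alpha> and \<beta>, \<open>Y0 t\<close> on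
    \<beta> and \<gamma>, and between them \<open>?N\<close> acts as the identity. Only t^2 times
    the \<beta>\<beta> pairing survives.\<close>
  have inner: "(F t ** X0 t ** transpose (F t)) \<bullet> (J t ** Y0 t ** transpose (J t)) = 0" for t
  proof -
    let ?N = "transpose (F t) ** J t"
    have Y0_row: "Y0 t $ k $ l = 0" if "0 < lam $ k" for k l
      using that by (auto simp: Y0_def diag_mat_def B_def)
    have Y0_col: "Y0 t $ k $ l = 0" if "0 < lam $ l" for k l
      using that by (auto simp: Y0_def diag_mat_def B_def)
    have NY: "(?N ** Y0 t) $ i $ l = Y0 t $ i $ l" if "0 \<le> lam $ i" for i l
    proof -
      have "?N $ i $ k * Y0 t $ k $ l = mat 1 $ i $ k * Y0 t $ k $ l" for k
        using N[OF that, of k t] Y0_row[of k l] by (cases "0 < lam $ k") simp_all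
      then have "(?N ** Y0 t) $ i $ l = (mat 1 ** Y0 t) $ i $ l"
        by (simp only: matrix_matrix_mult_def vec_lambda_beta)
      then show ?thesis by simp
    qed
    have NYN: "(?N ** Y0 t ** transpose ?N) $ i $ j = Y0 t $ i $ j"
      if "0 \<le> lam $ i" "0 \<le> lam $ j" for i j
    proof -
      have "(?N ** Y0 t) $ i $ l * transpose ?N $ l $ j = Y0 t $ i $ l * mat 1 $ l $ j" for l
      proof (cases "0 < lam $ l")
        case True
        then show ?thesis by (simp only: NY[OF that(1)] Y0_col)
      next
        case False
        then have "transpose ?N $ l $ j = mat 1 $ j $ l"
          using N[OF that(2), of l t] by (simp add: transpose_def)
        then show ?thesis by (simp only: NY[OF that(1)]) (simp add: mat_def)
      qed
      then have "(?N ** Y0 t ** transpose ?N) $ i $ j = (Y0 t ** mat 1) $ i $ j"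
        by (simp only: matrix_matrix_mult_def[of "?N ** Y0 t"] matrix_matrix_mult_def[of "Y0 t"]
            vec_lambda_beta)
      then show ?thesis by simp
    qed
    have "(F t ** X0 t ** transpose (F t)) \<bullet> (J t ** Y0 t ** transpose (J t)) =
        X0 t \<bullet> (?N ** Y0 t ** transpose ?N)"
      by (simp only: inner_matrix_mult_right[of "F t ** X0 t" "transpose (F t)"]
          inner_matrix_mult_left[of "F t" "X0 t"] matrix_transpose_mul transpose_transpose
          matrix_mul_assoc)
    also have "\<dots> = (\<Sum>i\<in>UNIV. \<Sum>j\<in>UNIV. X0 t $ i $ j * (?N ** Y0 t ** transpose ?N) $ i $ j)"
      by (rule inner_matrix)
    also have "\<dots> = (\<Sum>i\<in>UNIV. \<Sum>j\<in>UNIV. t\<^sup>2 * (B H $ i $ j * B K $ i $ j))"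
    proof (intro sum.cong refl)
      fix i j
      show "X0 t $ i $ j * (?N ** Y0 t ** transpose ?N) $ i $ j = t\<^sup>2 * (B H $ i $ j * B K $ i $ j)"
      proof (cases "0 \<le> lam $ i \<and> 0 \<le> lam $ j")
        case True
        then show ?thesis
          by (simp only: NYN) (auto simp: X0_def Y0_def diag_mat_def B_def power2_eq_square)
      next
        case False
        then have "X0 t $ i $ j = 0" "B H $ i $ j = 0"
          by (auto simp: X0_def diag_mat_def B_def)
        then show ?thesis by simp
      qed
    qed
    also have "\<dots> = t\<^sup>2 * (\<Sum>i\<in>UNIV. \<Sum>j\<in>UNIV. B H $ i $ j * B K $ i $ j)"
      by (simp only: sum_distrib_left)
    also have "(\<Sum>i\<in>UNIV. \<Sum>j\<in>UNIV. B H $ i $ j * B K $ i $ j) = inner_block ?\<beta> H K"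
    proof -
      have "(\<Sum>j\<in>UNIV. B H $ i $ j * B K $ i $ j) = (\<Sum>j\<in>?\<beta>. H $ i $ j * K $ i $ j)"
        if "lam $ i = 0" for i
        using that by (intro sum.mono_neutral_cong_right) (auto simp: B_def)
      then show ?thesis
        unfolding inner_block_def by (intro sum.mono_neutral_cong_right) (auto simp: B_def)
    qed
    finally show ?thesis using psd(3) by simp
  qed

  have in_graph: "J t ** Y0 t ** transpose (J t) \<in> psd_normal (F t ** X0 t ** transpose (F t))"
    if "0 < t" for t
  proof -
    have "B H \<in> psd_cone" "B (- K) \<in> psd_cone"
      using block_psd[OF psd(1)] block_psd[OF psd(2)] by (simp_all add: B_def)
    moreover have "?D \<in> psd_cone" "diag_mat (\<chi> i. - min (lam $ i) 0) \<in> psd_cone"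
      by (simp_all add: diag_mat_psd)
    ultimately have "X0 t \<in> psd_cone"
      and "diag_mat (\<chi> i. - min (lam $ i) 0) + t *\<^sub>R B (- K) \<in> psd_cone"
      using that by (simp_all add: X0_def psd_cone_add psd_cone_scaleR)
    moreover have "diag_mat (\<chi> i. - min (lam $ i) 0) + t *\<^sub>R B (- K) = - Y0 t"
      by (simp add: Y0_def B_def diag_mat_def vec_eq_iff)
    ultimately have "F t ** X0 t ** transpose (F t) \<in> psd_cone"
      and "J t ** (- Y0 t) ** transpose (J t) \<in> psd_cone"
      by (simp_all only: psd_cone_congruence)
    then show ?thesis
      using inner[of t] by (simp add: psd_normal_iff matrix_mult.minus_left matrix_mult.minus_right)
  qed

  have zero: "F 0 = mat 1" "J 0 = mat 1" "X0 0 = ?D" "Y0 0 = ?E"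
    by (simp_all add: F_def J_def R_def S_def X0_def Y0_def)
  have "(F has_vector_derivative W + V) (at 0)"
    using matrix_mult.has_vector_derivative[OF affine_has_vector_derivative[of "mat 1" W 0]
        affine_has_vector_derivative[of "mat 1" V 0]]
    by (simp add: F_def[abs_def] R_def add.commute)
  moreover have "(X0 has_vector_derivative B H) (at 0)"
    unfolding X0_def by (rule affine_has_vector_derivative)
  ultimately have "((\<lambda>t. F t ** X0 t ** transpose (F t)) has_vector_derivative
      ?D ** transpose (W + V) + (B H + (W + V) ** ?D)) (at 0)"
    using congruence_has_vector_derivative[of F "W + V" 0 X0 "B H"] by (simp add: zero)
  \<comment> \<open>Nine sign cases: \<open>V\<close> yields \<alpha>\<alpha>, \<open>B H\<close>
    yields \<beta>\<beta>, \<open>W\<close> and its transpose yield the other blocks meeting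
    \<alpha>, and the rest vanish by \<open>Hneg\<close>.\<close>
  moreover have "?D ** transpose (W + V) + (B H + (W + V) ** ?D) = H"
  proof -
    have "max (lam $ i) 0 * (W + V) $ j $ i + (B H $ i $ j + (W + V) $ i $ j * max (lam $ j) 0) =
        H $ i $ j" for i j
      using Hneg[of i j] Hneg[of j i] sym_matsD[OF symH, of i j]
      by (cases "lam $ i" "0::real" rule: linorder_cases;
          cases "lam $ j" "0::real" rule: linorder_cases)
         (simp_all add: W_def V_def B_def)
    then show ?thesis
      by (simp add: vec_eq_iff diag_mat_mult_entry mult_diag_mat_entry transpose_def)
  qed
  ultimately have X: "((\<lambda>t. F t ** X0 t ** transpose (F t)) has_vector_derivative H) (at 0)"
    by simp

  have "(S has_vector_derivative - W) (at 0)"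
    unfolding S_def by (auto intro!: derivative_eq_intros)
  then have "(J has_vector_derivative U - transpose W) (at 0)"
    using matrix_mult.has_vector_derivative[OF
        bounded_linear.has_vector_derivative[OF bounded_linear_transpose, of S "- W" "at 0"]
        affine_has_vector_derivative[of "mat 1" U 0]]
    by (simp add: J_def[abs_def] S_def linear_neg[OF bounded_linear.linear[OF bounded_linear_transpose]])
  moreover have "(Y0 has_vector_derivative B K) (at 0)"
    unfolding Y0_def by (rule affine_has_vector_derivative)
  ultimately have "((\<lambda>t. J t ** Y0 t ** transpose (J t)) has_vector_derivative
      ?E ** transpose (U - transpose W) + (B K + (U - transpose W) ** ?E)) (at 0)"
    using congruence_has_vector_derivative[of J "U - transpose W" 0 Y0 "B K"] by (simp add: zero)
  \<comment> \<open>Here \<open>U\<close> yields \<gamma>\<gamma>, \<open>B K\<close> yields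
    \<beta>\<beta>, and \<open>W\<close> yields \<beta>\<gamma> and, through \<open>mixed\<close>,
    \<alpha>\<gamma>, with their mirror images; the rest vanish by \<open>Kpos\<close>.\<close>
  moreover have "?E ** transpose (U - transpose W) + (B K + (U - transpose W) ** ?E) = K"
  proof -
    have "min (lam $ i) 0 * (U $ j $ i - W $ i $ j) +
        (B K $ i $ j + (U $ i $ j - W $ j $ i) * min (lam $ j) 0) = K $ i $ j" for i j
      using Kpos[of i j] Kpos[of j i] mixed[of i j] mixed[of j i]
        sym_matsD[OF symH, of i j] sym_matsD[OF symK, of i j]
      by (cases "lam $ i" "0::real" rule: linorder_cases;
          cases "lam $ j" "0::real" rule: linorder_cases)
         (simp_all add: W_def U_def B_def field_simps)
    then show ?thesis
      by (simp add: vec_eq_iff diag_mat_mult_entry mult_diag_mat_entry transpose_def)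
  qed
  ultimately have Y: "((\<lambda>t. J t ** Y0 t ** transpose (J t)) has_vector_derivative K) (at 0)"
    by simp
  have "K \<in> graphical_derivative psd_normal
      (F 0 ** X0 0 ** transpose (F 0)) (J 0 ** Y0 0 ** transpose (J 0)) H"
    by (rule graphical_derivative_curve[OF X Y]) (rule in_graph)
  then show ?thesis
    by (simp only: zero matrix_mul_lid matrix_mul_rid transpose_mat)
qed

section \<open>Back to the optimization problem: general base points and \<Sigma>\<close>

text \<open>Transposition leaves \<open>G\<close> unchanged, so uniqueness of the derivative makes
  its values symmetric.\<close>

lemma derivative_in_sym_mats:
  assumes "G differentiable (at x)" and sym: "\<And>z. G z \<in> sym_mats"
  shows "frechet_derivative G (at x) \<xi> \<in> sym_mats"
proof -
  let ?G' = "frechet_derivative G (at x)"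
  have G: "(G has_derivative ?G') (at x)"
    using assms(1) by (simp add: frechet_derivative_works)
  have "((\<lambda>z. transpose (G z)) has_derivative (\<lambda>\<xi>. transpose (?G' \<xi>))) (at x)"
    by (rule bounded_linear.has_derivative[OF bounded_linear_transpose G])
  moreover have "(\<lambda>z. transpose (G z)) = G"
    using sym by (simp add: sym_mats_def)
  ultimately have "(G has_derivative (\<lambda>\<xi>. transpose (?G' \<xi>))) (at x)"
    by (simp only:)
  from has_derivative_unique[OF this G] have "(\<lambda>\<xi>. transpose (?G' \<xi>)) = ?G'" .
  from fun_cong[OF this, of \<xi>] show ?thesis
    by (simp add: sym_mats_def)
qed

text \<open>Both directions reduce to the diagonal pair by congruence. Symmetry of \<open>K\<close>
  is part of the right side because the tangent cone is formed in the space of all matrices.\<close>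

lemma graphical_derivative_psd_normal_iff:
  fixes X Y H K P :: "real^'p^'p"
  assumes "Y \<in> psd_normal X" and P: "orthogonal_matrix P"
    and A: "X + Y = P ** diag_mat lam ** transpose P"
    and H: "H \<in> sym_mats"
  shows "K \<in> graphical_derivative psd_normal X Y H \<longleftrightarrow>
    K \<in> sym_mats \<and> derivative_blocks lam (transpose P ** H ** P) (transpose P ** K ** P)"
proof -
  note diag = psd_normal_of_diag[OF assms(1-3)]
  have PP: "P ** transpose P = mat 1" and P': "orthogonal_matrix (transpose P)"
    using P by (simp_all add: orthogonal_matrix_def)
  have undo: "P ** (transpose P ** M ** P) ** transpose P = M" for M
    using congruence_inverse[of "transpose P" M] PP by simp
  show ?thesis
  proof
    assume K: "K \<in> graphical_derivative psd_normal X Y H"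
    from graphical_derivative_psd_normal_congruence[OF P K]
    have "transpose P ** K ** P \<in> graphical_derivative psd_normal (diag_mat (\<chi> i. max (lam $ i) 0))
        (diag_mat (\<chi> i. min (lam $ i) 0)) (transpose P ** H ** P)"
      unfolding diag .
    from derivative_blocks_necessary[OF this] sym_mats_congruence[of "transpose P ** K ** P" P]
    show "K \<in> sym_mats \<and> derivative_blocks lam (transpose P ** H ** P) (transpose P ** K ** P)"
      unfolding undo by blast
  next
    assume K: "K \<in> sym_mats \<and> derivative_blocks lam (transpose P ** H ** P) (transpose P ** K ** P)"
    have "transpose P ** M ** P \<in> sym_mats" if "M \<in> sym_mats" for M
      using sym_mats_congruence[OF that, of "transpose P"] by simp
    then have "transpose P ** K ** P \<in> graphical_derivative psd_normal
        (transpose P ** X ** P) (transpose P ** Y ** P) (transpose P ** H ** P)"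
      unfolding diag using K H by (intro derivative_blocks_sufficient) auto
    from graphical_derivative_psd_normal_congruence[OF P' this]
    show "K \<in> graphical_derivative psd_normal X Y H"
      by (simp only: transpose_transpose undo)
  qed
qed

text \<open>For these signs \<Sigma> has the entry \<open>lam $ i / (lam $ i - lam $ j)\<close>, so
  the two equations differ by the nonzero factor \<open>lam $ i - lam $ j\<close>.\<close>

lemma Sigma_mat_mixed:
  assumes "0 < lam $ i" "lam $ j < 0"
  shows "(Sigma_mat lam $ i $ j - 1) * h + Sigma_mat lam $ i $ j * k = 0 \<longleftrightarrow>
    lam $ j * h + lam $ i * k = 0"
proof -
  have "Sigma_mat lam $ i $ j = lam $ i / (lam $ i - lam $ j)"
    using assms by (simp add: Sigma_mat_def)
  moreover have "lam $ i - lam $ j \<noteq> 0" using assms by simp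
  ultimately have "(Sigma_mat lam $ i $ j - 1) * h + Sigma_mat lam $ i $ j * k =
      (lam $ j * h + lam $ i * k) / (lam $ i - lam $ j)"
    by (simp add: diff_divide_distrib field_simps)
  then show ?thesis using \<open>lam $ i - lam $ j \<noteq> 0\<close> by simp
qed

theorem corollary3p2:
  fixes f :: "real^'n \<Rightarrow> real"
    and G :: "real^'n \<Rightarrow> real^'p^'p"
    and xbar :: "real^'n"
    and ybar P :: "real^'p^'p"
    and lam :: "real^'p"
    and \<alpha> \<beta> \<gamma> :: "'p set"
  assumes "twice_cont_differentiable f"
    and "\<forall>x. G x \<in> sym_mats"
    and "twice_cont_differentiable G"
    and "KKT_point f G xbar ybar"
    and "orthogonal_matrix P"
    and "G xbar + ybar = P ** diag_mat lam ** transpose P"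
    and "\<alpha> = {i. 0 < lam $ i}"
    and "\<beta> = {i. lam $ i = 0}"
    and "\<gamma> = {i. lam $ i < 0}"
  shows "critical_multiplier f G xbar ybar \<longleftrightarrow>
    (\<exists>\<xi>::real^'n. \<exists>\<eta>\<in>sym_mats. \<xi> \<noteq> 0 \<and>
      hessian (Lagrangian f G ybar) xbar \<xi> + G_adj G xbar \<eta> = 0 \<and>
      (let H = transpose P ** frechet_derivative G (at xbar) \<xi> ** P;
           K = transpose P ** \<eta> ** P;
           S = Sigma_mat lam
       in (\<forall>i\<in>\<beta>. \<forall>j\<in>\<gamma>. H $ i $ j = 0) \<and>
          (\<forall>i\<in>\<gamma>. \<forall>j\<in>\<gamma>. H $ i $ j = 0) \<and>
          (\<forall>i\<in>\<alpha>. \<forall>j\<in>\<alpha>. K $ i $ j = 0) \<and>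
          (\<forall>i\<in>\<alpha>. \<forall>j\<in>\<beta>. K $ i $ j = 0) \<and>
          (\<forall>i\<in>\<alpha>. \<forall>j\<in>\<gamma>. (S $ i $ j - 1) * H $ i $ j + S $ i $ j * K $ i $ j = 0) \<and>
          psd_block \<beta> H \<and> nsd_block \<beta> K \<and> inner_block \<beta> H K = 0))"
proof -
  let ?D = "frechet_derivative G (at xbar)"
  let ?H = "\<lambda>\<xi>. transpose P ** ?D \<xi> ** P" and ?K = "\<lambda>\<eta>. transpose P ** \<eta> ** P"
  have multiplier: "ybar \<in> multipliers f G xbar" and normal: "ybar \<in> psd_normal (G xbar)"
    using assms(4) by (auto simp: KKT_point_def multipliers_def psd_normal_def)
  have "G differentiable (at xbar)"
    using assms(3) by (auto simp: twice_cont_differentiable_def differentiable_def)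
  then have "?D \<xi> \<in> sym_mats" for \<xi>
    using assms(2) by (intro derivative_in_sym_mats) auto
  note tangent = graphical_derivative_psd_normal_iff[OF normal assms(5,6) this]
  have blocks: "derivative_blocks lam H K \<longleftrightarrow>
      (\<forall>i\<in>\<beta>. \<forall>j\<in>\<gamma>. H $ i $ j = 0) \<and> (\<forall>i\<in>\<gamma>. \<forall>j\<in>\<gamma>. H $ i $ j = 0) \<and>
      (\<forall>i\<in>\<alpha>. \<forall>j\<in>\<alpha>. K $ i $ j = 0) \<and> (\<forall>i\<in>\<alpha>. \<forall>j\<in>\<beta>. K $ i $ j = 0) \<and>
      (\<forall>i\<in>\<alpha>. \<forall>j\<in>\<gamma>. (Sigma_mat lam $ i $ j - 1) * H $ i $ j + Sigma_mat lam $ i $ j * K $ i $ j = 0) \<and>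
      psd_block \<beta> H \<and> nsd_block \<beta> K \<and> inner_block \<beta> H K = 0" for H K
    unfolding derivative_blocks_def assms(7-9) by (auto simp: Sigma_mat_mixed)
  \<comment> \<open>The stationarity equation is common to both sides; only membership in the
    graphical derivative is exchanged for the block conditions.\<close>
  have "critical_multiplier f G xbar ybar \<longleftrightarrow>
      (\<exists>\<xi>. \<exists>\<eta>\<in>sym_mats. \<xi> \<noteq> 0 \<and>
        hessian (Lagrangian f G ybar) xbar \<xi> + G_adj G xbar \<eta> = 0 \<and>
        derivative_blocks lam (?H \<xi>) (?K \<eta>))"
    unfolding critical_multiplier_def image_iff Bex_def tangent
    using multiplier by (metis (no_types, lifting))
  then show ?thesis unfolding blocks Let_def .
qed

end
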